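(* Let $-\infty\le a<b\le\infty$, let $\varepsilon>0$, and let $Q$ be a real-valued function that is twice continuously differentiable on $(a,b)$ and satisfies $Q(x)\neq 0$ for all $x\in(a,b)$. Fix $x_0\in(a,b)$ and put $S_0(x)=\int_{x_0}^{x}\sqrt{Q(\xi)}\,d\xi$. Then the family $$y(x)=c_1\,Q(x)^{-1/4}e^{S_0(x)/\varepsilon}+c_2\,Q(x)^{-1/4}e^{-S_0(x)/\varepsilon},$$ with $c_1,c_2$ arbitrary constants, is the exact general solution on $(a,b)$ of the differential equation $$\varepsilon^2 y''=\widetilde Q(x)\,y,$$ where $$\widetilde Q(x)=Q(x)+\varepsilon^2\left(5\left(\frac{Q'(x)}{4Q(x)}\right)^2-\frac{Q''(x)}{4Q(x)}\right).$$
   Context: Conventions on roots: since $Q$ is continuous and nonvanishing on the interval, it has constant sign there. $\sqrt{Q}$ denotes a fixed continuous branch of the square root (equal to $i\sqrt{|Q|}$, up to sign, if $Q<0$), so that $(S_0')^2=Q$. $Q^{-1/4}$ denotes a fixed continuous branch; it may equivalently be replaced by $|Q|^{-1/4}$, since the two differ only by a constant factor that is absorbed into $c_1,c_2$. Solutions and the constants $c_1,c_2$ are allowed to be complex. "General solution" means that every function in the family solves the equation and every solution belongs to the family. *)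

theory Defs
  imports "HOL-Analysis.Analysis"
begin

definition sqrt_branch :: "real set \<Rightarrow> (real \<Rightarrow> real) \<Rightarrow> (real \<Rightarrow> complex) \<Rightarrow> bool" where
  "sqrt_branch I Q r \<longleftrightarrow>
     continuous_on I r \<and> (\<forall>x\<in>I. (r x)\<^sup>2 = complex_of_real (Q x))"

(* A continuous branch of the complex power Q^(-1/4). *)
definition inv_fourth_root_branch :: "real set \<Rightarrow> (real \<Rightarrow> real) \<Rightarrow> (real \<Rightarrow> complex) \<Rightarrow> bool" where
  "inv_fourth_root_branch I Q w \<longleftrightarrow>
     continuous_on I w \<and> (\<forall>x\<in>I. (w x)^4 = inverse (complex_of_real (Q x)))"

(* The interval integral is oriented: for x < x0 it is minus the integral from x to x0. *)
definition S0 :: "(real \<Rightarrow> complex) \<Rightarrow> real \<Rightarrow> real \<Rightarrow> complex" where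
  "S0 r x0 x = (LBINT t=ereal x0..ereal x. r t)"

(* Q1 and Q2 stand for the first and second derivatives of Q. *)
definition Q_tilde ::
    "real \<Rightarrow> (real \<Rightarrow> real) \<Rightarrow> (real \<Rightarrow> real) \<Rightarrow> (real \<Rightarrow> real) \<Rightarrow> real \<Rightarrow> real" where
  "Q_tilde \<epsilon> Q Q1 Q2 x =
     Q x + \<epsilon>\<^sup>2 * (5 * (Q1 x / (4 * Q x))\<^sup>2 - Q2 x / (4 * Q x))"

(* Intended for open I; the values of y outside I are irrelevant. *)
definition solves_on :: "real set \<Rightarrow> real \<Rightarrow> (real \<Rightarrow> real) \<Rightarrow> (real \<Rightarrow> complex) \<Rightarrow> bool" where
  "solves_on I \<epsilon> P y \<longleftrightarrow>
     (\<exists>y1 y2. \<forall>x\<in>I.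
        (y has_vector_derivative y1 x) (at x) \<and>
        (y1 has_vector_derivative y2 x) (at x) \<and>
        complex_of_real (\<epsilon>\<^sup>2) * y2 x = complex_of_real (P x) * y x)"

end

theory Submission
  imports Defs
begin

text \<open>The functions $y_\pm = w\,e^{\pm S_0/\varepsilon}$, with $w$ the branch of $Q^{-1/4}$, can be
  differentiated directly once one knows that $\sqrt Q = k\,w^{-2}$ for a constant $k = \pm 1$
  (a continuous square root of 1 on an interval is constant) and that
  $w' = -\frac{Q'}{4Q}\,w$. They solve the equation and have the constant Wronskian
  $-2k/\varepsilon \neq 0$. Conversely, if $y$ is a solution, its Wronskians with $y_+$ and
  $y_-$ are constant, and they are the coefficients of $y$ up to a common factor.\<close>

section \<open>Continuous branches of roots and the phase integral on an interval\<close>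

lemma convex_einterval: "convex (einterval a b)"
proof -
  have "is_interval (einterval a b)"
    unfolding is_interval_1
  proof (intro ballI allI impI)
    fix u v x assume "u \<in> einterval a b" "v \<in> einterval a b" "u \<le> x \<and> x \<le> v"
    then have "a < ereal u" "ereal u \<le> ereal x" "ereal x \<le> ereal v" "ereal v < b"
      by (auto simp: einterval_iff)
    then show "x \<in> einterval a b"
      unfolding einterval_iff by (blast intro: less_le_trans le_less_trans)
  qed
  then show ?thesis
    by (rule is_interval_convex)
qed

text \<open>The values lie in the finite set of \<open>n\<close>-th roots of unity, and a continuous
  map with finite range on a connected set is constant. This pins down branches of roots: two of
  them with equal \<open>n\<close>-th powers and no zeros differ by a constant factor.\<close>

lemma continuous_root_of_unity_constant:
  fixes f :: "'a::topological_space \<Rightarrow> complex"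
  assumes "connected S" "continuous_on S f" "n > 0"
    and "\<And>x. x \<in> S \<Longrightarrow> f x ^ n = 1"
  obtains c where "\<And>x. x \<in> S \<Longrightarrow> f x = c"
proof -
  have "finite {z::complex. z ^ n = 1}"
    using assms(3) by (intro finite_roots_unity) auto
  moreover have "f ` S \<subseteq> {z. z ^ n = 1}"
    using assms(4) by auto
  ultimately have "finite (f ` S)"
    using finite_subset by blast
  then have "f constant_on S"
    using assms(1,2) continuous_finite_range_constant by blast
  then show ?thesis
    using that unfolding constant_on_def by blast
qed

text \<open>The continuous branch $w$ is a constant multiple of the positive function
  $(Q^2)^{-1/8} = |Q|^{-1/4}$, which avoids a case distinction on the sign of $Q$.\<close>

lemma inv_fourth_root_branch_has_vector_derivative:
  assumes "open I" "connected I" "x \<in> I"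
    and Q: "\<And>x. x \<in> I \<Longrightarrow> (Q has_real_derivative Q1 x) (at x)"
    and nz: "\<And>x. x \<in> I \<Longrightarrow> Q x \<noteq> 0"
    and w: "inv_fourth_root_branch I Q w"
  shows "(w has_vector_derivative - of_real (Q1 x / (4 * Q x)) * w x) (at x)"
proof -
  define u where "u = (\<lambda>x. ((Q x)\<^sup>2) powr (-1/8))"
  have u_pos: "u x > 0" if "x \<in> I" for x
    using nz[OF that] by (simp add: u_def)
  have u8: "u x ^ 8 = inverse ((Q x)\<^sup>2)" if "x \<in> I" for x
    using nz[OF that] by (simp add: u_def powr_power inverse_eq_divide flip: powr_minus_divide)
  have u': "(u has_real_derivative - (Q1 x / (4 * Q x)) * u x) (at x)" if "x \<in> I" for x
  proof -
    have "((\<lambda>x. (Q x)\<^sup>2) has_real_derivative 2 * Q x * Q1 x) (at x)"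
      by (auto intro!: derivative_eq_intros Q[OF that])
    from DERIV_fun_powr[OF this, of "-1/8"] have "(u has_real_derivative
        (-1/8) * ((Q x)\<^sup>2) powr (-1/8 - 1) * (2 * Q x * Q1 x)) (at x)"
      using nz[OF that] unfolding u_def by simp
    moreover have "(-1/8) * ((Q x)\<^sup>2) powr (-1/8 - 1) * (2 * Q x * Q1 x)
        = - (Q1 x / (4 * Q x)) * u x"
      using nz[OF that] unfolding u_def powr_diff
      by (simp add: field_simps power2_eq_square)
    ultimately show ?thesis by metis
  qed
  have u_cont: "continuous_on I u"
    using u' by (meson DERIV_isCont continuous_at_imp_continuous_on)
  have cont: "continuous_on I (\<lambda>x. w x / of_real (u x))"
    using w u_pos u_cont unfolding inv_fourth_root_branch_def
    by (intro continuous_intros) force+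
  \<comment> \<open>Eighth powers are compared because the fourth powers of \<open>w\<close> and
    \<open>u\<close> are 1/Q and 1/|Q|, which have opposite signs where Q is negative.\<close>
  have root: "(w x / of_real (u x)) ^ 8 = 1" if "x \<in> I" for x
  proof -
    have "w x ^ 8 = (w x ^ 4) ^ 2"
      by (simp flip: power_mult)
    also have "\<dots> = of_real (inverse ((Q x)\<^sup>2))"
      using w that by (simp add: inv_fourth_root_branch_def power_inverse)
    also have "\<dots> = of_real (u x) ^ 8"
      using u8[OF that] by (metis of_real_power)
    finally show ?thesis
      using u_pos[OF that] by (simp add: power_divide)
  qed
  obtain c where c: "\<And>x. x \<in> I \<Longrightarrow> w x / of_real (u x) = c"
    using continuous_root_of_unity_constant[OF \<open>connected I\<close> cont _ root] by auto
  have w_eq: "w x = c * of_real (u x)" if "x \<in> I" for x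
    using c[OF that] u_pos[OF that] by (auto simp: field_simps)
  have "((\<lambda>x. c * of_real (u x)) has_vector_derivative
      c * of_real (- (Q1 x / (4 * Q x)) * u x)) (at x)"
    using u'[OF \<open>x \<in> I\<close>]
    by (intro has_vector_derivative_mult_right has_vector_derivative_of_real)
      (simp add: has_real_derivative_iff_has_vector_derivative)
  then have "(w has_vector_derivative c * of_real (- (Q1 x / (4 * Q x)) * u x)) (at x)"
    by (rule has_vector_derivative_transform_within_open[OF _ assms(1,3)]) (simp add: w_eq)
  then show ?thesis
    using w_eq[OF \<open>x \<in> I\<close>] by (simp add: mult_ac)
qed

text \<open>A continuous \<open>r\<close> has an antiderivative \<open>F\<close> on the whole open
  interval, bounded or not. By the fundamental theorem of calculus \<open>S0\<close> differs from
  \<open>F\<close> only by the constant \<open>F x0\<close>, on either side of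
  \<open>x0\<close>.\<close>

lemma S0_has_vector_derivative:
  assumes "continuous_on (einterval a b) r" "x0 \<in> einterval a b" "x \<in> einterval a b"
  shows "(S0 r x0 has_vector_derivative r x) (at x)"
proof -
  have mid: "t \<in> einterval a b"
    if "u \<in> einterval a b" "v \<in> einterval a b" "u \<le> t" "t \<le> v" for u v t
    using that convex_einterval[of a b] by (metis is_interval_convex_1 mem_is_interval_1_I)
  have isCont: "isCont r t" if "t \<in> einterval a b" for t
    using assms(1) that continuous_on_eq_continuous_at open_einterval by blast
  have "a < b"
    using assms(2) by (auto simp: einterval_iff)
  then obtain F where F:
    "\<And>t. t \<in> einterval a b \<Longrightarrow> (F has_vector_derivative r t) (at t)"
    using einterval_antiderivative[of a b r] isCont by (auto simp: einterval_iff)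
  have S0_eq: "S0 r x0 t = F t - F x0" if "t \<in> einterval a b" for t
  proof -
    have sub: "s \<in> einterval a b" if "s \<in> {min x0 t..max x0 t}" for s
      using that assms(2) \<open>t \<in> einterval a b\<close>
        mid[of x0 t s] mid[of t x0 s] by (auto simp: min_def max_def split: if_splits)
    show ?thesis
      unfolding S0_def using sub assms(1) F
      by (intro interval_integral_FTC_finite)
        (auto intro: continuous_on_subset has_vector_derivative_at_within)
  qed
  have "((\<lambda>t. F t - F x0) has_vector_derivative r x) (at x)"
    using F[OF assms(3)] by (auto intro!: derivative_eq_intros)
  then show ?thesis
    by (rule has_vector_derivative_transform_within_open[OF _ open_einterval assms(3)])
      (simp add: S0_eq)
qed

section \<open>Second-order linear equations without a first-order term\<close>

text \<open>In the derivative of the Wronskian the products \<open>f1 x * g1 x\<close> cancel, and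
  so do the terms \<open>p x * f x * g x\<close>, since both functions satisfy the same
  equation.\<close>

lemma wronskian_constant:
  fixes f g :: "real \<Rightarrow> complex"
  assumes "convex I"
    and "\<And>x. x \<in> I \<Longrightarrow> (f has_vector_derivative f1 x) (at x)"
    and "\<And>x. x \<in> I \<Longrightarrow> (f1 has_vector_derivative p x * f x) (at x)"
    and "\<And>x. x \<in> I \<Longrightarrow> (g has_vector_derivative g1 x) (at x)"
    and "\<And>x. x \<in> I \<Longrightarrow> (g1 has_vector_derivative p x * g x) (at x)"
  obtains c where "\<And>x. x \<in> I \<Longrightarrow> f x * g1 x - f1 x * g x = c"
proof -
  have "((\<lambda>x. f x * g1 x - f1 x * g x) has_vector_derivative 0) (at x within I)"
    if "x \<in> I" for x
  proof -
    have "((\<lambda>x. f x * g1 x - f1 x * g x) has_vector_derivative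
        (f x * (p x * g x) + f1 x * g1 x) - (f1 x * g1 x + p x * f x * g x)) (at x)"
      using assms(2-)[OF that]
      by (intro has_vector_derivative_diff has_vector_derivative_mult)
    then show ?thesis
      by (simp add: algebra_simps has_vector_derivative_at_within)
  qed
  then show ?thesis
    using has_vector_derivative_zero_constant[OF assms(1)] that by blast
qed

text \<open>This is Cramer's rule with Wronskians: y (f g' - f' g) = (y g' - y' g) f - (y f' - y' f)
  g holds identically, and all three brackets are constant. Dividing by \<omega> gives the
  coefficients.\<close>

lemma linear_ode2_solution_combination:
  fixes f g y :: "real \<Rightarrow> complex"
  assumes "convex I"
    and f: "\<And>x. x \<in> I \<Longrightarrow> (f has_vector_derivative f1 x) (at x)"
      "\<And>x. x \<in> I \<Longrightarrow> (f1 has_vector_derivative p x * f x) (at x)"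
    and g: "\<And>x. x \<in> I \<Longrightarrow> (g has_vector_derivative g1 x) (at x)"
      "\<And>x. x \<in> I \<Longrightarrow> (g1 has_vector_derivative p x * g x) (at x)"
    and y: "\<And>x. x \<in> I \<Longrightarrow> (y has_vector_derivative y1 x) (at x)"
      "\<And>x. x \<in> I \<Longrightarrow> (y1 has_vector_derivative p x * y x) (at x)"
    and W: "\<And>x. x \<in> I \<Longrightarrow> f x * g1 x - f1 x * g x = \<omega>" and "\<omega> \<noteq> 0"
  obtains c1 c2 where "\<And>x. x \<in> I \<Longrightarrow> y x = c1 * f x + c2 * g x"
proof -
  obtain \<alpha> where \<alpha>: "\<And>x. x \<in> I \<Longrightarrow> y x * f1 x - y1 x * f x = \<alpha>"
    using wronskian_constant[OF assms(1) y f] by blast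
  obtain \<beta> where \<beta>: "\<And>x. x \<in> I \<Longrightarrow> y x * g1 x - y1 x * g x = \<beta>"
    using wronskian_constant[OF assms(1) y g] by blast
  have "y x = \<beta> / \<omega> * f x + (- \<alpha> / \<omega>) * g x" if "x \<in> I" for x
  proof -
    have "y x * \<omega> = \<beta> * f x - \<alpha> * g x"
      unfolding \<alpha>[OF that, symmetric] \<beta>[OF that, symmetric] W[OF that, symmetric]
      by (simp add: algebra_simps)
    then show ?thesis
      using \<open>\<omega> \<noteq> 0\<close> by (simp add: field_simps)
  qed
  then show ?thesis
    using that by blast
qed

lemma solves_on_linear_combination:
  assumes "open I" "\<epsilon> \<noteq> 0"
    and f: "\<And>x. x \<in> I \<Longrightarrow> (f has_vector_derivative f1 x) (at x)"
      "\<And>x. x \<in> I \<Longrightarrow> (f1 has_vector_derivative of_real (P x) / of_real (\<epsilon>\<^sup>2) * f x) (at x)"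
    and g: "\<And>x. x \<in> I \<Longrightarrow> (g has_vector_derivative g1 x) (at x)"
      "\<And>x. x \<in> I \<Longrightarrow> (g1 has_vector_derivative of_real (P x) / of_real (\<epsilon>\<^sup>2) * g x) (at x)"
    and y: "\<And>x. x \<in> I \<Longrightarrow> y x = c1 * f x + c2 * g x"
  shows "solves_on I \<epsilon> P y"
  unfolding solves_on_def
proof (intro exI ballI conjI)
  fix x assume x: "x \<in> I"
  have "((\<lambda>x. c1 * f x + c2 * g x) has_vector_derivative c1 * f1 x + c2 * g1 x) (at x)"
    using f(1)[OF x] g(1)[OF x] by (auto intro!: derivative_eq_intros)
  then show "(y has_vector_derivative c1 * f1 x + c2 * g1 x) (at x)"
    by (rule has_vector_derivative_transform_within_open[OF _ assms(1) x]) (simp add: y)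
  show "((\<lambda>x. c1 * f1 x + c2 * g1 x) has_vector_derivative
      c1 * (of_real (P x) / of_real (\<epsilon>\<^sup>2) * f x) + c2 * (of_real (P x) / of_real (\<epsilon>\<^sup>2) * g x)) (at x)"
    using f(2)[OF x] g(2)[OF x] by (auto intro!: derivative_eq_intros)
  show "complex_of_real (\<epsilon>\<^sup>2) * (c1 * (of_real (P x) / of_real (\<epsilon>\<^sup>2) * f x)
      + c2 * (of_real (P x) / of_real (\<epsilon>\<^sup>2) * g x)) = of_real (P x) * y x"
    using \<open>\<epsilon> \<noteq> 0\<close> by (simp add: y[OF x] field_simps)
qed

section \<open>Products of an amplitude and an exponential phase\<close>

text \<open>The phase derivative \<open>s / (w x)\<^sup>2\<close> is chosen so that the first-order
  terms cancel: differentiating \<open>s / w x\<close> gives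
  \<open>- s * w1 x / (w x)\<^sup>2\<close>, and the exponential contributes the opposite term. This
  is why the amplitude Q^(-1/4) fits the phase derivative sqrt Q.\<close>

lemma exp_over_square_has_vector_derivative:
  fixes w T :: "real \<Rightarrow> complex"
  assumes w: "(w has_vector_derivative w1 x) (at x)" "(w1 has_vector_derivative w2) (at x)"
    and T: "(T has_vector_derivative s / (w x)\<^sup>2) (at x)"
    and nz: "w x \<noteq> 0"
  shows "((\<lambda>x. w x * exp (T x)) has_vector_derivative (w1 x + s / w x) * exp (T x)) (at x)"
    and "((\<lambda>x. (w1 x + s / w x) * exp (T x)) has_vector_derivative
           (w2 + s\<^sup>2 / w x ^ 3) * exp (T x)) (at x)"
proof -
  have E: "((\<lambda>x. exp (T x)) has_vector_derivative s / (w x)\<^sup>2 * exp (T x)) (at x)"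
    using field_vector_diff_chain_at[OF T DERIV_exp] by (simp add: o_def)
  have "((\<lambda>x. inverse (w x)) has_vector_derivative w1 x * (- (inverse (w x) ^ 2))) (at x)"
    using field_vector_diff_chain_at[OF w(1) DERIV_inverse[OF nz]]
    by (simp add: o_def numeral_2_eq_2)
  then have "((\<lambda>x. w1 x + s * inverse (w x)) has_vector_derivative
      w2 + s * (w1 x * (- (inverse (w x) ^ 2)))) (at x)"
    by (intro has_vector_derivative_add has_vector_derivative_mult_right w(2))
  then have A: "((\<lambda>x. w1 x + s / w x) has_vector_derivative w2 - s * w1 x / (w x)\<^sup>2) (at x)"
    by (simp add: field_simps)
  show "((\<lambda>x. w x * exp (T x)) has_vector_derivative (w1 x + s / w x) * exp (T x)) (at x)"
    using has_vector_derivative_mult[OF w(1) E] nz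
    by (simp add: field_simps power2_eq_square)
  have "(w1 x + s / w x) * (s / (w x)\<^sup>2 * exp (T x)) + (w2 - s * w1 x / (w x)\<^sup>2) * exp (T x)
      = (w2 + s\<^sup>2 / w x ^ 3) * exp (T x)"
    using nz by (simp add: field_simps power2_eq_square power3_eq_cube)
  then show "((\<lambda>x. (w1 x + s / w x) * exp (T x)) has_vector_derivative
           (w2 + s\<^sup>2 / w x ^ 3) * exp (T x)) (at x)"
    using has_vector_derivative_mult[OF A E] by simp
qed

theorem theorem1:
  fixes a b :: ereal and \<epsilon> x0 :: real
    and Q Q1 Q2 :: "real \<Rightarrow> real"
    and r w :: "real \<Rightarrow> complex"
  assumes "a < b" and "\<epsilon> > 0"
    and "\<And>x. x \<in> einterval a b \<Longrightarrow> (Q has_real_derivative Q1 x) (at x)"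
    and "\<And>x. x \<in> einterval a b \<Longrightarrow> (Q1 has_real_derivative Q2 x) (at x)"
    and "continuous_on (einterval a b) Q2"
    and "\<And>x. x \<in> einterval a b \<Longrightarrow> Q x \<noteq> 0"
    and "x0 \<in> einterval a b"
    and "sqrt_branch (einterval a b) Q r"
    and "inv_fourth_root_branch (einterval a b) Q w"
  shows "\<forall>y :: real \<Rightarrow> complex.
    solves_on (einterval a b) \<epsilon> (Q_tilde \<epsilon> Q Q1 Q2) y \<longleftrightarrow>
    (\<exists>c1 c2 :: complex. \<forall>x \<in> einterval a b.
       y x = c1 * w x * exp (S0 r x0 x / complex_of_real \<epsilon>)
           + c2 * w x * exp (- S0 r x0 x / complex_of_real \<epsilon>))"
proof -
  define I where "I = einterval a b"
  define \<epsilon>' where "\<epsilon>' = complex_of_real \<epsilon>"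
  define P where "P = Q_tilde \<epsilon> Q Q1 Q2"
  define p where "p x = complex_of_real (P x) / of_real (\<epsilon>\<^sup>2)" for x
  define w1 where "w1 x = - of_real (Q1 x / (4 * Q x)) * w x" for x
  \<comment> \<open>The coefficient in w'' = q w; multiplied by \<epsilon>^2 it is exactly the
    correction term of \<open>Q_tilde\<close>.\<close>
  define q where "q x = 5 * (Q1 x / (4 * Q x))\<^sup>2 - Q2 x / (4 * Q x)" for x
  note Q' = assms(3)[folded I_def] and Q1' = assms(4)[folded I_def]
    and Qnz = assms(6)[folded I_def] and x0 = assms(7)[folded I_def]
    and r = assms(8)[folded I_def] and w = assms(9)[folded I_def]
  have e: "\<epsilon>' \<noteq> 0" "\<epsilon>'\<^sup>2 = of_real (\<epsilon>\<^sup>2)"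
    using assms(2) by (simp_all add: \<epsilon>'_def)
  have I: "open I" "convex I" "connected I"
    by (simp_all add: I_def open_einterval convex_einterval convex_connected)
  have w4: "w x ^ 4 = inverse (of_real (Q x))" if "x \<in> I" for x
    using w that by (simp add: inv_fourth_root_branch_def)
  have wnz: "w x \<noteq> 0" if "x \<in> I" for x
    using w4[OF that] Qnz[OF that] by auto
  have w': "(w has_vector_derivative w1 x) (at x)" if "x \<in> I" for x
    unfolding w1_def
    using inv_fourth_root_branch_has_vector_derivative[OF I(1,3) that Q' Qnz w] .
  \<comment> \<open>With a = Q'/(4Q), the factor -a has derivative 4 a^2 - Q''/(4Q), and w' = -a w
    adds another a^2 by the product rule; hence the 5 in \<open>q\<close>.\<close>
  have w1': "(w1 has_vector_derivative of_real (q x) * w x) (at x)" if "x \<in> I" for x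
  proof -
    have "((\<lambda>x. - (Q1 x / (4 * Q x))) has_real_derivative
        4 * (Q1 x / (4 * Q x))\<^sup>2 - Q2 x / (4 * Q x)) (at x)"
      using Qnz[OF that]
      by (auto intro!: derivative_eq_intros Q'[OF that] Q1'[OF that]
          simp: field_simps power2_eq_square)
    then have "((\<lambda>x. complex_of_real (- (Q1 x / (4 * Q x)))) has_vector_derivative
        of_real (4 * (Q1 x / (4 * Q x))\<^sup>2 - Q2 x / (4 * Q x))) (at x)"
      by (intro has_vector_derivative_of_real)
        (simp add: has_real_derivative_iff_has_vector_derivative)
    from has_vector_derivative_mult[OF this w'[OF that]]
    show ?thesis
      unfolding w1_def q_def by (simp add: algebra_simps power2_eq_square)
  qed
  have r2w4: "(r x * (w x)\<^sup>2)\<^sup>2 = 1" if "x \<in> I" for x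
    using r w4[OF that] Qnz[OF that] that
    by (simp add: sqrt_branch_def power_mult_distrib flip: power_mult)
  have "continuous_on I (\<lambda>x. r x * (w x)\<^sup>2)"
    using r w by (auto simp: sqrt_branch_def inv_fourth_root_branch_def intro!: continuous_intros)
  from continuous_root_of_unity_constant[OF I(3) this _ r2w4]
  obtain k where k: "\<And>x. x \<in> I \<Longrightarrow> r x * (w x)\<^sup>2 = k" by auto
  have k2: "k\<^sup>2 = 1"
    using r2w4[OF x0] k[OF x0] by simp
  have S': "((\<lambda>x. \<sigma> * S0 r x0 x / \<epsilon>') has_vector_derivative (\<sigma> * k / \<epsilon>') / (w x)\<^sup>2) (at x)"
    if "x \<in> I" for x \<sigma>
  proof -
    have "(S0 r x0 has_vector_derivative r x) (at x)"
      using r x0 that unfolding I_def sqrt_branch_def by (blast intro: S0_has_vector_derivative)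
    then have "((\<lambda>x. (\<sigma> / \<epsilon>') * S0 r x0 x) has_vector_derivative (\<sigma> / \<epsilon>') * r x) (at x)"
      by (rule has_vector_derivative_mult_right)
    moreover have "r x = k / (w x)\<^sup>2"
      using k[OF that] wnz[OF that] by (simp add: field_simps)
    ultimately show ?thesis by simp
  qed
  \<comment> \<open>Both exponentials are handled at once through a sign \<sigma>. Only
    \<open>\<sigma>\<^sup>2\<close> enters the second derivative, so the two signs lead to the same
    equation.\<close>
  define f where "f \<sigma> x = w x * exp (\<sigma> * S0 r x0 x / \<epsilon>')" for \<sigma> x
  define f1 where "f1 \<sigma> x = (w1 x + (\<sigma> * k / \<epsilon>') / w x) * exp (\<sigma> * S0 r x0 x / \<epsilon>')" for \<sigma> x
  have f': "(f \<sigma> has_vector_derivative f1 \<sigma> x) (at x)" if "x \<in> I" for \<sigma> x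
    unfolding f_def f1_def
    using exp_over_square_has_vector_derivative(1)[OF w'[OF that] w1'[OF that] S'[OF that] wnz[OF that]] .
  have f1': "(f1 \<sigma> has_vector_derivative p x * f \<sigma> x) (at x)" if "x \<in> I" "\<sigma>\<^sup>2 = 1" for \<sigma> x
  proof -
    \<comment> \<open>The relation w^4 = 1/Q turns the nonlinear term s^2 / w^3 into a multiple of
      \<open>w x\<close>, and s^2 = 1/\<epsilon>^2 because \<sigma> and \<open>k\<close> both square
      to 1.\<close>
    have "1 / w x ^ 3 = of_real (Q x) * w x"
      using w4[OF that(1)] wnz[OF that(1)] Qnz[OF that(1)]
      by (simp add: field_simps power_numeral_reduce)
    moreover have "(\<sigma> * k / \<epsilon>')\<^sup>2 = 1 / \<epsilon>'\<^sup>2"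
      using k2 that(2) by (simp add: power_mult_distrib power_divide)
    ultimately have "(\<sigma> * k / \<epsilon>')\<^sup>2 / w x ^ 3 = of_real (Q x) / \<epsilon>'\<^sup>2 * w x"
      by (metis divide_divide_eq_left mult.commute times_divide_eq_left times_divide_eq_right mult_1)
    moreover have "p x = of_real (q x) + of_real (Q x) / \<epsilon>'\<^sup>2"
      using assms(2) unfolding p_def P_def Q_tilde_def q_def[symmetric] e(2)
      by (simp add: field_simps)
    ultimately have "(of_real (q x) * w x + (\<sigma> * k / \<epsilon>')\<^sup>2 / w x ^ 3) = p x * w x"
      by (simp add: algebra_simps)
    with exp_over_square_has_vector_derivative(2)
      [OF w'[OF that(1)] w1'[OF that(1)] S'[OF that(1)] wnz[OF that(1)], of \<sigma>]
    show ?thesis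
      unfolding f_def f1_def by (simp add: mult.assoc)
  qed
  \<comment> \<open>The two exponentials are reciprocal and the terms with \<open>w1\<close> cancel;
    each product leaves \<open>- k / \<epsilon>'\<close>.\<close>
  have W: "f 1 x * f1 (-1) x - f1 1 x * f (-1) x = - 2 * k / \<epsilon>'" if "x \<in> I" for x
  proof -
    define E where "E = exp (S0 r x0 x / \<epsilon>')"
    have E: "E \<noteq> 0" "exp (- (S0 r x0 x / \<epsilon>')) = inverse E"
      by (simp_all add: E_def exp_minus)
    show ?thesis
      using wnz[OF that] e(1) E(1) unfolding f_def f1_def
      by (simp add: E(2) field_simps flip: E_def)
  qed
  have Wnz: "- 2 * k / \<epsilon>' \<noteq> 0"
    using k2 e(1) by auto
  have main: "solves_on I \<epsilon> P y \<longleftrightarrow> (\<exists>c1 c2. \<forall>x\<in>I. y x = c1 * f 1 x + c2 * f (-1) x)" for y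
  proof
    assume "solves_on I \<epsilon> P y"
    then obtain y1 y2 where y: "\<And>x. x \<in> I \<Longrightarrow> (y has_vector_derivative y1 x) (at x)"
      "\<And>x. x \<in> I \<Longrightarrow> (y1 has_vector_derivative y2 x) (at x)"
      "\<And>x. x \<in> I \<Longrightarrow> complex_of_real (\<epsilon>\<^sup>2) * y2 x = of_real (P x) * y x"
      unfolding solves_on_def by blast
    have "y2 x = p x * y x" if "x \<in> I" for x
      using y(3)[OF that] assms(2) by (simp add: p_def field_simps)
    then have "(y1 has_vector_derivative p x * y x) (at x)" if "x \<in> I" for x
      using y(2) that by metis
    \<comment> \<open>The Wronskian \<open>W\<close> selects the signs 1 and -1, whose squares are 1
      as \<open>f1'\<close> requires.\<close>
    from linear_ode2_solution_combination[OF I(2) f' f1' f' f1' y(1) this W Wnz]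
    show "\<exists>c1 c2. \<forall>x\<in>I. y x = c1 * f 1 x + c2 * f (-1) x"
      by (metis one_power2 power2_minus)
  next
    assume "\<exists>c1 c2. \<forall>x\<in>I. y x = c1 * f 1 x + c2 * f (-1) x"
    then obtain c1 c2 where y: "\<And>x. x \<in> I \<Longrightarrow> y x = c1 * f 1 x + c2 * f (-1) x"
      by blast
    show "solves_on I \<epsilon> P y"
      using assms(2) f' f1' y unfolding p_def
      by (intro solves_on_linear_combination[OF I(1), where f = "f 1" and g = "f (-1)"]) auto
  qed
  show ?thesis
    using main unfolding I_def P_def f_def \<epsilon>'_def by (simp add: mult.assoc)
qed

end
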